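(* Let $(G,c)$ be a network whose Laplacian $\Delta$ is unbounded as an operator on $\ell^2(G)$ (with domain $\operatorname{span}\{\delta_x\}_{x\in G}$). Then $\ell^2(G)$ is unboundedly contained in $\mathcal H_{\mathcal E}$.
   Context: A network $(G,c)$ is a connected weighted undirected graph with vertex set $G$, given by a symmetric function $c:G\times G\to[0,\infty)$, $(x,y)\mapsto c_{xy}=c_{yx}$, with $c_{xx}=0$; write $x\sim y$ iff $c_{xy}>0$. It is locally finite (each $x$ has only finitely many $y$ with $y\sim x$) and connected (any two vertices are joined by a finite path of edges with positive conductance). The Laplacian acts on functions by $(\Delta u)(x)=\sum_{y\sim x}c_{xy}(u(x)-u(y))$. The energy form is $\mathcal E(u,v)=\frac12\sum_{x,y\in G}c_{xy}(u(x)-u(y))(v(x)-v(y))$ on $\operatorname{dom}\mathcal E=\{u:G\to\mathbb R:\mathcal E(u,u)<\infty\}$. The energy space $\mathcal H_{\mathcal E}:=\operatorname{dom}\mathcal E/\mathbb R\mathbf 1$ (functions of finite energy modulo constants) is a Hilbert space with inner product $\langle u,v\rangle_{\mathcal H_{\mathcal E}}=\mathcal E(u,v)$ (in the complex-valued case $\mathcal E(\bar u,v)$). $\ell^2(G)$ is the space of square-summable functions on $G$ (counting measure), with $\langle u,v\rangle_{\ell^2}=\sum_x u(x)v(x)$. $\delta_x$ denotes both the characteristic function of $\{x\}$ in $\ell^2(G)$ and the element of $\mathcal H_{\mathcal E}$ it represents (it has finite energy). Unbounded containment: a Hilbert space $K$ is boundedly contained in a Hilbert space $H$ if the inclusion is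 bounded, i.e. $\|k\|_H\le C\|k\|_K$ for all $k\in K$, for some $C<\infty$. $K$ is unboundedly contained in $H$ if no such bound holds but $K$ has a dense linear subspace $K_0$ which is included in $H$ and for which the inclusion map $J:K_0\subseteq K\to H$ is closable. Here a finite-energy function in $\ell^2(G)$ is included in $\mathcal H_{\mathcal E}$ by sending it to its class modulo constants; not every element of $\ell^2(G)$ need have finite energy (in which case the bound is considered to fail). *)

theory Defs
  imports "HOL-Analysis.Analysis" "HOL-Library.Function_Algebras"
begin

instantiation "fun" :: (type, real_vector) real_vector
begin

definition scaleR_fun :: "real \<Rightarrow> ('a \<Rightarrow> 'b) \<Rightarrow> 'a \<Rightarrow> 'b" where
  "scaleR_fun r f = (\<lambda>x. r *\<^sub>R f x)"

instance
  by standard (auto simp: scaleR_fun_def fun_eq_iff algebra_simps)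

end


section \<open>Operators between Hilbert spaces and unbounded containment\<close>

text \<open>
  A real Hilbert space is given by a linear subspace of vectors inside an ambient real vector
  space, together with an inner product which is only meaningful on those vectors. This
  representation is needed because the energy space depends on the conductance function, hence
  cannot be a type.
\<close>

record 'v hilbert =
  vectors :: "'v set"
  ip :: "'v \<Rightarrow> 'v \<Rightarrow> real"

definition hnorm :: "'v hilbert \<Rightarrow> 'v \<Rightarrow> real" where
  "hnorm H v = sqrt (ip H v v)"

definition converges_in :: "'v::real_vector hilbert \<Rightarrow> (nat \<Rightarrow> 'v) \<Rightarrow> 'v \<Rightarrow> bool" where
  "converges_in H s v \<longleftrightarrow> (\<lambda>n. hnorm H (s n - v)) \<longlonglongrightarrow> 0"

definition dense_in :: "'v::real_vector hilbert \<Rightarrow> 'v set \<Rightarrow> bool" where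
  "dense_in H D \<longleftrightarrow> (\<forall>v\<in>vectors H. \<forall>\<epsilon>>0. \<exists>d\<in>D. hnorm H (v - d) < \<epsilon>)"

definition bounded_op :: "'k hilbert \<Rightarrow> 'h hilbert \<Rightarrow> 'k set \<Rightarrow> ('k \<Rightarrow> 'h) \<Rightarrow> bool" where
  "bounded_op K H D T \<longleftrightarrow>
     T ` D \<subseteq> vectors H \<and> (\<exists>C. \<forall>k\<in>D. hnorm H (T k) \<le> C * hnorm K k)"

text \<open>The closure of the graph of \<open>T\<close>, with domain \<open>D\<close>, in the product of \<open>K\<close> and \<open>H\<close>.\<close>

definition graph_closure ::
    "'k::real_vector hilbert \<Rightarrow> 'h::real_vector hilbert \<Rightarrow> 'k set \<Rightarrow> ('k \<Rightarrow> 'h) \<Rightarrow> ('k \<times> 'h) set" where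
  "graph_closure K H D T =
     {(k, h). k \<in> vectors K \<and> h \<in> vectors H \<and>
       (\<exists>s. range s \<subseteq> D \<and> converges_in K s k \<and> converges_in H (\<lambda>n. T (s n)) h)}"

definition closable_op ::
    "'k::real_vector hilbert \<Rightarrow> 'h::real_vector hilbert \<Rightarrow> 'k set \<Rightarrow> ('k \<Rightarrow> 'h) \<Rightarrow> bool" where
  "closable_op K H D T \<longleftrightarrow> single_valued (graph_closure K H D T)"

text \<open>
  In the containment notions, \<open>J\<close> is the map on the ambient vector spaces that identifies vectors
  of \<open>K\<close> with vectors of \<open>H\<close>; a vector \<open>k\<close> of \<open>K\<close> is included in \<open>H\<close> iff \<open>J k \<in> vectors H\<close>.
\<close>

definition boundedly_contained :: "'k hilbert \<Rightarrow> 'h hilbert \<Rightarrow> ('k \<Rightarrow> 'h) \<Rightarrow> bool" where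
  "boundedly_contained K H J \<longleftrightarrow> bounded_op K H (vectors K) J"

definition unboundedly_contained ::
    "'k::real_vector hilbert \<Rightarrow> 'h::real_vector hilbert \<Rightarrow> ('k \<Rightarrow> 'h) \<Rightarrow> bool" where
  "unboundedly_contained K H J \<longleftrightarrow>
     \<not> boundedly_contained K H J \<and>
     (\<exists>K0. subspace K0 \<and> K0 \<subseteq> vectors K \<and> dense_in K K0 \<and>
        J ` K0 \<subseteq> vectors H \<and> closable_op K H K0 J)"


section \<open>Networks\<close>

text \<open>The vertex set is the universe of the type \<open>'a\<close>.\<close>

definition network :: "('a \<Rightarrow> 'a \<Rightarrow> real) \<Rightarrow> bool" where
  "network c \<longleftrightarrow>
     (\<forall>x y. c x y \<ge> 0) \<and> (\<forall>x y. c x y = c y x) \<and> (\<forall>x. c x x = 0) \<and>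
     (\<forall>x. finite {y. c x y > 0}) \<and>
     (\<forall>x y. (\<lambda>u v. c u v > 0)\<^sup>*\<^sup>* x y)"

definition laplacian :: "('a \<Rightarrow> 'a \<Rightarrow> real) \<Rightarrow> ('a \<Rightarrow> real) \<Rightarrow> 'a \<Rightarrow> real" where
  "laplacian c u x = (\<Sum>y | c x y > 0. c x y * (u x - u y))"

definition delta :: "'a \<Rightarrow> 'a \<Rightarrow> real" where
  "delta x = indicator {x}"

definition ell2 :: "('a \<Rightarrow> real) hilbert" where
  "ell2 = \<lparr>vectors = {u. (\<lambda>x. (u x)\<^sup>2) summable_on UNIV},
           ip = (\<lambda>u v. \<Sum>\<^sub>\<infinity>x. u x * v x)\<rparr>"

lemma laplacian_span_delta_ell2:
  assumes "network c" "u \<in> span (range delta)"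
  shows "laplacian c u \<in> vectors ell2"
proof -
  have "finite {x. u x \<noteq> 0}"
    using assms(2)
  proof (induction rule: span_induct_alt)
    case base
    show ?case by simp
  next
    case (step r d v)
    then obtain z where "d = delta z" by blast
    then have "{x. (r *\<^sub>R d + v) x \<noteq> 0} \<subseteq> insert z {x. v x \<noteq> 0}"
      by (auto simp: scaleR_fun_def delta_def indicator_def)
    then show ?case using step by (meson finite.insertI finite_subset)
  qed
  then have fin: "finite ({x. u x \<noteq> 0} \<union> (\<Union>y\<in>{x. u x \<noteq> 0}. {x. c y x > 0}))"
    (is "finite ?S")
    using assms(1) by (auto simp: network_def)
  have "laplacian c u x = 0" if "x \<notin> ?S" for x
  proof -
    have "c x y = c y x" for y using assms(1) by (simp add: network_def)
    then have "c x y * (u x - u y) = 0" if "c x y > 0" for y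
      using that \<open>x \<notin> ?S\<close> by auto
    then show ?thesis by (auto simp: laplacian_def intro!: sum.neutral)
  qed
  then have "(\<lambda>x. (laplacian c u x)\<^sup>2) summable_on UNIV \<longleftrightarrow> (\<lambda>x. (laplacian c u x)\<^sup>2) summable_on ?S"
    by (intro summable_on_cong_neutral) auto
  then show ?thesis using fin by (simp add: ell2_def)
qed

definition energy :: "('a \<Rightarrow> 'a \<Rightarrow> real) \<Rightarrow> ('a \<Rightarrow> real) \<Rightarrow> ('a \<Rightarrow> real) \<Rightarrow> real" where
  "energy c u v = 1 / 2 * (\<Sum>\<^sub>\<infinity>(x, y). c x y * (u x - u y) * (v x - v y))"

text \<open>Since conductances are nonnegative, \<open>summable_on\<close> says that the energy sum is finite.\<close>

definition dom_energy :: "('a \<Rightarrow> 'a \<Rightarrow> real) \<Rightarrow> ('a \<Rightarrow> real) set" where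
  "dom_energy c = {u. (\<lambda>(x, y). c x y * (u x - u y) * (u x - u y)) summable_on UNIV}"


section \<open>The energy space\<close>

text \<open>All real functions modulo constants; the energy space is a subspace of this.\<close>

quotient_type 'a mod_const = "'a \<Rightarrow> real" / "\<lambda>u v. \<exists>k. u = v + (\<lambda>_. k)"
  morphisms rep_mod_const mod_const
proof (rule equivpI)
  show "reflp (\<lambda>(u :: 'a \<Rightarrow> real) v. \<exists>k. u = v + (\<lambda>_. k))"
    by (auto intro!: reflpI exI[of _ 0] simp: fun_eq_iff)
  show "symp (\<lambda>(u :: 'a \<Rightarrow> real) v. \<exists>k. u = v + (\<lambda>_. k))"
  proof (rule sympI)
    fix u v :: "'a \<Rightarrow> real" assume "\<exists>k. u = v + (\<lambda>_. k)"
    then obtain k where "u = v + (\<lambda>_. k)" by blast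
    then have "v = u + (\<lambda>_. - k)" by (simp add: fun_eq_iff)
    then show "\<exists>k. v = u + (\<lambda>_. k)" by blast
  qed
  show "transp (\<lambda>(u :: 'a \<Rightarrow> real) v. \<exists>k. u = v + (\<lambda>_. k))"
  proof (rule transpI)
    fix u v w :: "'a \<Rightarrow> real" assume "\<exists>k. u = v + (\<lambda>_. k)" "\<exists>k. v = w + (\<lambda>_. k)"
    then obtain k l where "u = v + (\<lambda>_. k)" "v = w + (\<lambda>_. l)" by blast
    then have "u = w + (\<lambda>_. l + k)" by (simp add: fun_eq_iff)
    then show "\<exists>k. u = w + (\<lambda>_. k)" by blast
  qed
qed

instantiation mod_const :: (type) real_vector
begin

lift_definition zero_mod_const :: "'a mod_const" is 0 .

lift_definition plus_mod_const :: "'a mod_const \<Rightarrow> 'a mod_const \<Rightarrow> 'a mod_const" is "(+)"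
proof -
  fix u u' v v' :: "'a \<Rightarrow> real"
  assume "\<exists>k. u = u' + (\<lambda>_. k)" "\<exists>k. v = v' + (\<lambda>_. k)"
  then obtain k l where "u = u' + (\<lambda>_. k)" "v = v' + (\<lambda>_. l)" by blast
  then have "u + v = u' + v' + (\<lambda>_. k + l)" by (simp add: fun_eq_iff)
  then show "\<exists>k. u + v = u' + v' + (\<lambda>_. k)" by blast
qed

lift_definition minus_mod_const :: "'a mod_const \<Rightarrow> 'a mod_const \<Rightarrow> 'a mod_const" is "(-)"
proof -
  fix u u' v v' :: "'a \<Rightarrow> real"
  assume "\<exists>k. u = u' + (\<lambda>_. k)" "\<exists>k. v = v' + (\<lambda>_. k)"
  then obtain k l where "u = u' + (\<lambda>_. k)" "v = v' + (\<lambda>_. l)" by blast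
  then have "u - v = u' - v' + (\<lambda>_. k - l)" by (simp add: fun_eq_iff)
  then show "\<exists>k. u - v = u' - v' + (\<lambda>_. k)" by blast
qed

lift_definition uminus_mod_const :: "'a mod_const \<Rightarrow> 'a mod_const" is uminus
proof -
  fix u u' :: "'a \<Rightarrow> real"
  assume "\<exists>k. u = u' + (\<lambda>_. k)"
  then obtain k where "u = u' + (\<lambda>_. k)" by blast
  then have "- u = - u' + (\<lambda>_. - k)" by (simp add: fun_eq_iff)
  then show "\<exists>k. - u = - u' + (\<lambda>_. k)" by blast
qed

lift_definition scaleR_mod_const :: "real \<Rightarrow> 'a mod_const \<Rightarrow> 'a mod_const" is "scaleR"
proof -
  fix r and u u' :: "'a \<Rightarrow> real"
  assume "\<exists>k. u = u' + (\<lambda>_. k)"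
  then obtain k where "u = u' + (\<lambda>_. k)" by blast
  then have "r *\<^sub>R u = r *\<^sub>R u' + (\<lambda>_. r * k)"
    by (simp add: fun_eq_iff scaleR_fun_def algebra_simps)
  then show "\<exists>k. r *\<^sub>R u = r *\<^sub>R u' + (\<lambda>_. k)" by blast
qed

instance
  by standard
    (transfer; rule exI[of _ 0]; simp add: fun_eq_iff scaleR_fun_def algebra_simps)+

end

lift_definition energy_ip :: "('a \<Rightarrow> 'a \<Rightarrow> real) \<Rightarrow> 'a mod_const \<Rightarrow> 'a mod_const \<Rightarrow> real"
  is energy
  by (auto simp: energy_def fun_eq_iff)

definition energy_space :: "('a \<Rightarrow> 'a \<Rightarrow> real) \<Rightarrow> 'a mod_const hilbert" where
  "energy_space c = \<lparr>vectors = mod_const ` dom_energy c, ip = energy_ip c\<rparr>"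

lemma mod_const_in_energy_space_iff: "mod_const u \<in> vectors (energy_space c) \<longleftrightarrow> u \<in> dom_energy c"
proof
  assume "mod_const u \<in> vectors (energy_space c)"
  then obtain v where v: "v \<in> dom_energy c" "mod_const u = mod_const v"
    by (auto simp: energy_space_def)
  then obtain k where "u = v + (\<lambda>_. k)" by (auto simp: mod_const.abs_eq_iff)
  then show "u \<in> dom_energy c" using v(1) by (simp add: dom_energy_def)
qed (simp add: energy_space_def)

end

theory Submission
  imports Defs
begin

text \<open>
  The finitely supported functions form the span of the \<open>\<delta>\<^sub>x\<close>. They are dense in \<open>\<ell>\<^sup>2(G)\<close> and have
  finite energy by local finiteness, so they serve as the dense domain \<open>K\<^sub>0\<close> of the inclusion.

  Closability needs only pointwise information. Convergence in \<open>\<ell>\<^sup>2(G)\<close> implies pointwise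
  convergence, and convergence in energy implies convergence of the difference \<open>u x - u y\<close> along
  every edge. If \<open>s n \<rightarrow> k\<close> in \<open>\<ell>\<^sup>2(G)\<close> and \<open>s n \<rightarrow> v\<close> in energy, then \<open>k\<close> and \<open>v\<close> have the same
  differences along all edges; by connectedness they agree modulo constants. Hence the closure of
  the graph is contained in the graph of the quotient map (\<open>graph_closure_mod_const\<close>).

  The inclusion is not bounded because a bound \<open>\<parallel>u\<parallel>\<^sub>\<E> \<le> C \<parallel>u\<parallel>\<^sub>2\<close> would make the Laplacian bounded.
  Applied to \<open>\<delta>\<^sub>x\<close>, it bounds all degrees \<open>c(x) = \<Sum>\<^sub>y c\<^sub>x\<^sub>y\<close> by \<open>2 C\<^sup>2\<close>. The Cauchy-Schwarz inequality
  gives \<open>(\<Delta>u x)\<^sup>2 \<le> c(x) \<Sum>\<^sub>y c\<^sub>x\<^sub>y (u x - u y)\<^sup>2\<close>, and summation over \<open>x\<close> yields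
  \<open>\<parallel>\<Delta>u\<parallel>\<^sup>2 \<le> 2 C\<^sup>2 \<cdot> 2 \<E>(u, u) \<le> 4 C\<^sup>4 \<parallel>u\<parallel>\<^sup>2\<close> (\<open>laplacian_bounded_if_boundedly_contained\<close>).
\<close>


section \<open>Square-summable functions\<close>

lemma summable_on_weighted_square_diff:
  fixes w f g :: "'b \<Rightarrow> real"
  assumes "\<And>i. i \<in> A \<Longrightarrow> w i \<ge> 0"
    and "(\<lambda>i. w i * (f i)\<^sup>2) summable_on A" "(\<lambda>i. w i * (g i)\<^sup>2) summable_on A"
  shows "(\<lambda>i. w i * (f i - g i)\<^sup>2) summable_on A"
proof (rule summable_on_comparison_test)
  show "(\<lambda>i. 2 * (w i * (f i)\<^sup>2) + 2 * (w i * (g i)\<^sup>2)) summable_on A"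
    using assms(2,3) by (intro summable_on_add summable_on_cmult_right)
  fix i assume "i \<in> A"
  have "(f i - g i)\<^sup>2 \<le> 2 * (f i)\<^sup>2 + 2 * (g i)\<^sup>2"
    using zero_le_power2[of "f i + g i"] by (simp add: power2_eq_square algebra_simps)
  then have "w i * (f i - g i)\<^sup>2 \<le> w i * (2 * (f i)\<^sup>2 + 2 * (g i)\<^sup>2)"
    using assms(1)[OF \<open>i \<in> A\<close>] by (rule mult_left_mono)
  then show "w i * (f i - g i)\<^sup>2 \<le> 2 * (w i * (f i)\<^sup>2) + 2 * (w i * (g i)\<^sup>2)"
    by (simp add: algebra_simps)
qed (use assms(1) in auto)

lemma vectors_ell2_iff: "u \<in> vectors ell2 \<longleftrightarrow> (\<lambda>x. (u x)\<^sup>2) summable_on UNIV"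
  by (simp add: ell2_def)

lemma vectors_ell2_diff:
  assumes "u \<in> vectors ell2" "v \<in> vectors ell2"
  shows "u - v \<in> vectors ell2"
  using summable_on_weighted_square_diff[of UNIV "\<lambda>_. 1" u v] assms
  by (simp add: vectors_ell2_iff)

lemma hnorm_ell2_square: "(hnorm ell2 u)\<^sup>2 = (\<Sum>\<^sub>\<infinity>x. (u x)\<^sup>2)"
  by (simp add: hnorm_def ell2_def power2_eq_square infsum_nonneg)

lemma hnorm_ell2_nonneg: "hnorm ell2 u \<ge> 0"
  by (simp add: hnorm_def ell2_def infsum_nonneg)

lemma finite_support_in_ell2:
  assumes "finite {x. u x \<noteq> 0}"
  shows "u \<in> vectors ell2"
proof -
  have "(\<lambda>x. (u x)\<^sup>2) summable_on UNIV \<longleftrightarrow> (\<lambda>x. (u x)\<^sup>2) summable_on {x. u x \<noteq> 0}"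
    by (rule summable_on_cong_neutral) auto
  then show ?thesis using assms by (simp add: vectors_ell2_iff)
qed

lemma converges_in_ell2_pointwise:
  assumes "\<And>n. s n \<in> vectors ell2" "k \<in> vectors ell2" "converges_in ell2 s k"
  shows "(\<lambda>n. s n x) \<longlonglongrightarrow> k x"
proof -
  have "\<bar>s n x - k x\<bar> \<le> hnorm ell2 (s n - k)" for n
  proof (rule abs_le_square_iff[THEN iffD2, THEN order_trans])
    have "(\<lambda>x. ((s n - k) x)\<^sup>2) summable_on UNIV"
      using vectors_ell2_diff[OF assms(1,2)] by (simp only: vectors_ell2_iff)
    then have "(\<Sum>y\<in>{x}. ((s n - k) y)\<^sup>2) \<le> (\<Sum>\<^sub>\<infinity>x. ((s n - k) x)\<^sup>2)"
      by (rule finite_sum_le_infsum) auto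
    then show "(s n x - k x)\<^sup>2 \<le> (hnorm ell2 (s n - k))\<^sup>2"
      by (simp add: hnorm_ell2_square)
  qed (simp add: hnorm_ell2_nonneg)
  then have "(\<lambda>n. s n x - k x) \<longlonglongrightarrow> 0"
    by (intro Lim_null_comparison[OF _ assms(3)[unfolded converges_in_def]]) simp
  then show ?thesis by (simp add: LIM_zero_iff)
qed


section \<open>Finitely supported functions\<close>

lemma span_delta: "span (range delta) = {u :: 'a \<Rightarrow> real. finite {x. u x \<noteq> 0}}"
proof (intro equalityI subsetI CollectI)
  fix u :: "'a \<Rightarrow> real" assume "u \<in> span (range delta)"
  then show "finite {x. u x \<noteq> 0}"
  proof (induction rule: span_induct_alt)
    case base
    show ?case by simp
  next
    case (step r d v)
    then obtain z where "d = delta z" by blast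
    then have "{x. (r *\<^sub>R d + v) x \<noteq> 0} \<subseteq> insert z {x. v x \<noteq> 0}"
      by (auto simp: scaleR_fun_def delta_def indicator_def)
    then show ?case using step by (meson finite.insertI finite_subset)
  qed
next
  fix u :: "'a \<Rightarrow> real" assume "u \<in> {u. finite {x. u x \<noteq> 0}}"
  then have fin: "finite {x. u x \<noteq> 0}" by simp
  have eval: "(\<Sum>z\<in>F. u z *\<^sub>R delta z) y = (if y \<in> F then u y else 0)" if "finite F" for F y
    using that by (induction) (auto simp: scaleR_fun_def delta_def indicator_def)
  have "u = (\<Sum>z | u z \<noteq> 0. u z *\<^sub>R delta z)"
    using eval[OF fin] by (auto simp: fun_eq_iff)
  also have "\<dots> \<in> span (range delta)"
    by (intro span_sum span_scale span_base) auto
  finally show "u \<in> span (range delta)" .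
qed

lemma dense_in_ell2_span_delta: "dense_in ell2 (span (range delta))"
  unfolding dense_in_def
proof (intro ballI allI impI)
  fix u :: "'a \<Rightarrow> real" and \<epsilon> :: real assume u: "u \<in> vectors ell2" and "\<epsilon> > 0"
  have summable: "(\<lambda>x. (u x)\<^sup>2) summable_on UNIV" using u by (simp add: vectors_ell2_iff)
  obtain F where F: "finite F" "dist (\<Sum>x\<in>F. (u x)\<^sup>2) (\<Sum>\<^sub>\<infinity>x. (u x)\<^sup>2) \<le> \<epsilon>\<^sup>2 / 2"
    using infsum_finite_approximation[OF summable, of "\<epsilon>\<^sup>2 / 2"] \<open>\<epsilon> > 0\<close> by auto
  define d where "d = (\<lambda>x. if x \<in> F then u x else 0)"
  have "d \<in> span (range delta)"
    using F(1) by (auto simp: span_delta d_def intro: finite_subset[of _ F])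
  moreover have "hnorm ell2 (u - d) < \<epsilon>"
  proof -
    have "(hnorm ell2 (u - d))\<^sup>2 = (\<Sum>\<^sub>\<infinity>x\<in>UNIV - F. (u x)\<^sup>2)"
      unfolding hnorm_ell2_square by (rule infsum_cong_neutral) (auto simp: d_def)
    also have "\<dots> = (\<Sum>\<^sub>\<infinity>x. (u x)\<^sup>2) - (\<Sum>x\<in>F. (u x)\<^sup>2)"
      using F(1) by (simp add: infsum_Diff[OF summable])
    also have "\<dots> \<le> \<epsilon>\<^sup>2 / 2" using F(2) unfolding dist_real_def by linarith
    also have "\<dots> < \<epsilon>\<^sup>2" using \<open>\<epsilon> > 0\<close> by simp
    finally show ?thesis using \<open>\<epsilon> > 0\<close> by (simp add: power_less_imp_less_base)
  qed
  ultimately show "\<exists>d\<in>span (range delta). hnorm ell2 (u - d) < \<epsilon>" by blast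
qed


section \<open>Energy\<close>

text \<open>
  The contribution of an ordered pair of vertices to the energy of \<open>u\<close>. Every edge occurs as two
  ordered pairs, so the sum over all pairs is twice the energy.
\<close>

definition pair_energy :: "('a \<Rightarrow> 'a \<Rightarrow> real) \<Rightarrow> ('a \<Rightarrow> real) \<Rightarrow> 'a \<times> 'a \<Rightarrow> real" where
  "pair_energy c u p = c (fst p) (snd p) * (u (fst p) - u (snd p))\<^sup>2"

lemma pair_energy_eq: "(\<lambda>(x, y). c x y * (u x - u y) * (u x - u y)) = pair_energy c u"
  by (auto simp: fun_eq_iff pair_energy_def power2_eq_square)

lemma dom_energy_iff: "u \<in> dom_energy c \<longleftrightarrow> pair_energy c u summable_on UNIV"
  by (simp add: dom_energy_def pair_energy_eq)

lemma energy_self: "2 * energy c u u = infsum (pair_energy c u) UNIV"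
  by (simp add: energy_def pair_energy_eq)

lemma pair_energy_nonneg: "network c \<Longrightarrow> pair_energy c u p \<ge> 0"
  by (simp add: network_def pair_energy_def)

lemma hnorm_energy_square:
  assumes "network c"
  shows "2 * (hnorm (energy_space c) (mod_const u))\<^sup>2 = infsum (pair_energy c u) UNIV"
proof -
  have "energy c u u \<ge> 0"
    using energy_self[of c u] infsum_nonneg[of UNIV "pair_energy c u"] assms
    by (simp add: pair_energy_nonneg)
  then show ?thesis
    by (simp add: hnorm_def energy_space_def energy_ip.abs_eq energy_self)
qed

lemma hnorm_energy_nonneg:
  assumes "network c"
  shows "hnorm (energy_space c) (mod_const u) \<ge> 0"
  using energy_self[of c u] infsum_nonneg[of UNIV "pair_energy c u"] assms
  by (simp add: hnorm_def energy_space_def energy_ip.abs_eq pair_energy_nonneg)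

lemma sum_pair_energy_le:
  assumes "network c" "u \<in> dom_energy c" "finite P"
  shows "sum (pair_energy c u) P \<le> 2 * (hnorm (energy_space c) (mod_const u))\<^sup>2"
  unfolding hnorm_energy_square[OF assms(1)]
  using assms by (intro finite_sum_le_infsum) (auto simp: dom_energy_iff pair_energy_nonneg)

lemma dom_energy_diff:
  assumes "network c" "u \<in> dom_energy c" "v \<in> dom_energy c"
  shows "u - v \<in> dom_energy c"
proof -
  let ?w = "\<lambda>p. c (fst p) (snd p)"
  let ?du = "\<lambda>p. u (fst p) - u (snd p)" and ?dv = "\<lambda>p. v (fst p) - v (snd p)"
  have "(\<lambda>p. ?w p * (?du p - ?dv p)\<^sup>2) summable_on UNIV"
    using assms
    by (intro summable_on_weighted_square_diff[where f = ?du and g = ?dv])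
      (simp_all add: dom_energy_iff pair_energy_def[abs_def] network_def)
  also have "(\<lambda>p. ?w p * (?du p - ?dv p)\<^sup>2) = pair_energy c (u - v)"
    by (simp add: fun_eq_iff pair_energy_def algebra_simps)
  finally show ?thesis by (simp add: dom_energy_iff)
qed

lemma finite_support_in_dom_energy:
  assumes "network c" "finite {x. u x \<noteq> 0}"
  shows "u \<in> dom_energy c"
proof -
  let ?S = "{x. u x \<noteq> 0}"
  let ?N = "?S \<union> (\<Union>x\<in>?S. {y. c x y > 0})"
  have "finite ?N" using assms by (auto simp: network_def)
  have "pair_energy c u (x, y) = 0" if "(x, y) \<notin> ?N \<times> ?N" for x y
  proof (rule ccontr)
    assume nz: "pair_energy c u (x, y) \<noteq> 0"
    then have "c x y > 0" "c y x > 0"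
      using assms(1) by (auto simp: pair_energy_def network_def less_le)
    moreover have "x \<in> ?S \<or> y \<in> ?S" using nz by (auto simp: pair_energy_def)
    ultimately show False using that by blast
  qed
  then have "pair_energy c u summable_on UNIV \<longleftrightarrow> pair_energy c u summable_on ?N \<times> ?N"
    by (intro summable_on_cong_neutral) auto
  then show ?thesis using \<open>finite ?N\<close> by (simp add: dom_energy_iff)
qed

lemma converges_in_energy_edge_diff:
  assumes "network c" "\<And>n. s n \<in> dom_energy c" "v \<in> dom_energy c"
    and "converges_in (energy_space c) (\<lambda>n. mod_const (s n)) (mod_const v)"
    and "c x y > 0"
  shows "(\<lambda>n. s n x - s n y) \<longlonglongrightarrow> v x - v y"
proof -
  let ?h = "\<lambda>n. hnorm (energy_space c) (mod_const (s n - v))"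
  have "?h \<longlonglongrightarrow> 0"
    using assms(4) by (simp add: converges_in_def minus_mod_const.abs_eq)
  then have "(\<lambda>n. 2 * (?h n)\<^sup>2 / c x y) \<longlonglongrightarrow> 2 * 0\<^sup>2 / c x y"
    by (intro tendsto_intros) (use assms(5) in auto)
  then have lim: "(\<lambda>n. 2 * (?h n)\<^sup>2 / c x y) \<longlonglongrightarrow> 0" by simp
  have "((s n x - s n y) - (v x - v y))\<^sup>2 \<le> 2 * (?h n)\<^sup>2 / c x y" for n
  proof -
    have "(\<Sum>p\<in>{(x, y)}. pair_energy c (s n - v) p) \<le> 2 * (?h n)\<^sup>2"
      using assms(1-3) by (intro sum_pair_energy_le dom_energy_diff) auto
    moreover have "(\<Sum>p\<in>{(x, y)}. pair_energy c (s n - v) p) =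
        c x y * ((s n x - s n y) - (v x - v y))\<^sup>2"
      by (simp add: pair_energy_def algebra_simps)
    ultimately show ?thesis
      using assms(5) by (simp add: pos_le_divide_eq mult.commute)
  qed
  then have "(\<lambda>n. ((s n x - s n y) - (v x - v y))\<^sup>2) \<longlonglongrightarrow> 0"
    by (intro Lim_null_comparison[OF _ lim]) auto
  then have "(\<lambda>n. (s n x - s n y) - (v x - v y)) \<longlonglongrightarrow> 0"
    using tendsto_real_sqrt tendsto_rabs_zero_cancel by fastforce
  then show ?thesis by (simp add: LIM_zero_iff)
qed


section \<open>Closability\<close>

lemma network_eq_mod_const:
  assumes "network c" "\<And>x y. c x y > 0 \<Longrightarrow> u x - u y = v x - v y"
  shows "mod_const u = mod_const v"
proof -
  \<comment> \<open>an arbitrary base vertex; \<open>u - v\<close> is constant along paths starting there\<close>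
  define z :: 'a where "z = undefined"
  have "u x - v x = u z - v z" for x
  proof -
    have "(\<lambda>x y. c x y > 0)\<^sup>*\<^sup>* z x" using assms(1) by (simp add: network_def)
    then show ?thesis
    proof induction
      case (step x y)
      then show ?case using assms(2)[of x y] by simp
    qed simp
  qed
  then have "u = v + (\<lambda>_. u z - v z)" by (auto simp: fun_eq_iff algebra_simps)
  then show ?thesis by (auto simp: mod_const.abs_eq_iff)
qed

lemma graph_closure_mod_const:
  assumes "network c" "D \<subseteq> vectors ell2" "D \<subseteq> dom_energy c"
    and "(k, h) \<in> graph_closure ell2 (energy_space c) D mod_const"
  shows "h = mod_const k"
proof -
  from assms(4) obtain s where k: "k \<in> vectors ell2" and h: "h \<in> vectors (energy_space c)"
    and s: "range s \<subseteq> D" "converges_in ell2 s k"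
      "converges_in (energy_space c) (\<lambda>n. mod_const (s n)) h"
    by (auto simp: graph_closure_def)
  obtain v where v: "v \<in> dom_energy c" "h = mod_const v"
    using h by (auto simp: energy_space_def)
  have "s n \<in> vectors ell2" "s n \<in> dom_energy c" for n using s(1) assms(2,3) by auto
  note pointwise = converges_in_ell2_pointwise[OF this(1) k s(2)]
    and edge = converges_in_energy_edge_diff[OF assms(1) this(2) v(1) s(3)[unfolded v(2)]]
  have "v x - v y = k x - k y" if "c x y > 0" for x y
    using edge[OF that] tendsto_diff[OF pointwise[of x] pointwise[of y]] by (rule LIMSEQ_unique)
  then show ?thesis unfolding v(2) by (rule network_eq_mod_const[OF assms(1)])
qed


section \<open>Unboundedness\<close>

text \<open>The Cauchy-Schwarz inequality, with \<open>c\<^sub>x\<^sub>y\<close> split as \<open>\<surd>c\<^sub>x\<^sub>y \<cdot> \<surd>c\<^sub>x\<^sub>y\<close>.\<close>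

lemma laplacian_square_le:
  assumes "network c"
  shows "(laplacian c u x)\<^sup>2 \<le> (\<Sum>y | c x y > 0. c x y) * (\<Sum>y | c x y > 0. pair_energy c u (x, y))"
proof -
  have "laplacian c u x = (\<Sum>y | c x y > 0. sqrt (c x y) * (sqrt (c x y) * (u x - u y)))"
    unfolding laplacian_def by (intro sum.cong) (auto simp: mult.assoc[symmetric])
  then have "(laplacian c u x)\<^sup>2 \<le> (\<Sum>y | c x y > 0. (sqrt (c x y))\<^sup>2) *
      (\<Sum>y | c x y > 0. (sqrt (c x y) * (u x - u y))\<^sup>2)"
    by (simp only: Cauchy_Schwarz_ineq_sum)
  also have "(\<Sum>y | c x y > 0. (sqrt (c x y))\<^sup>2) = (\<Sum>y | c x y > 0. c x y)"
    by (intro sum.cong) auto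
  also have "(\<Sum>y | c x y > 0. (sqrt (c x y) * (u x - u y))\<^sup>2) =
      (\<Sum>y | c x y > 0. pair_energy c u (x, y))"
    by (intro sum.cong) (auto simp: pair_energy_def power_mult_distrib)
  finally show ?thesis .
qed

text \<open>
  In fact \<open>\<E>(\<delta>\<^sub>x, \<delta>\<^sub>x) = c(x)\<close>. Only the ordered pairs with first component \<open>x\<close> are used below, which
  loses a factor 2 but needs no symmetry.
\<close>

lemma degree_le_if_energy_bound:
  assumes "network c" "hnorm (energy_space c) (mod_const (delta x)) \<le> C * hnorm ell2 (delta x)"
  shows "(\<Sum>y | c x y > 0. c x y) \<le> 2 * C\<^sup>2"
proof -
  have fin: "finite {y. c x y > 0}" and loop: "c x x = 0"
    using assms(1) by (auto simp: network_def)
  have dom: "delta x \<in> dom_energy c"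
    using assms(1) by (rule finite_support_in_dom_energy) (simp add: delta_def indicator_def)
  have "(hnorm ell2 (delta x))\<^sup>2 = (\<Sum>\<^sub>\<infinity>y\<in>{x}. (delta x y)\<^sup>2)"
    unfolding hnorm_ell2_square
    by (rule infsum_cong_neutral) (auto simp: delta_def indicator_def)
  then have norm: "hnorm ell2 (delta x) = 1"
    using hnorm_ell2_nonneg[of "delta x"]
    by (simp add: delta_def power2_eq_1_iff)
  have "(\<Sum>y | c x y > 0. c x y) = (\<Sum>y | c x y > 0. pair_energy c (delta x) (x, y))"
    using loop by (intro sum.cong) (auto simp: pair_energy_def delta_def indicator_def)
  also have "\<dots> = sum (pair_energy c (delta x)) (Pair x ` {y. c x y > 0})"
    by (subst sum.reindex) (auto simp: inj_on_def)
  also have "\<dots> \<le> 2 * (hnorm (energy_space c) (mod_const (delta x)))\<^sup>2"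
    using fin by (intro sum_pair_energy_le assms(1) dom) auto
  also have "\<dots> \<le> 2 * C\<^sup>2"
    using assms(2) hnorm_energy_nonneg[OF assms(1), of "delta x"] by (simp add: norm power_mono)
  finally show ?thesis .
qed

lemma laplacian_bounded_if_boundedly_contained:
  assumes "network c" "boundedly_contained ell2 (energy_space c) mod_const"
  shows "bounded_op ell2 ell2 (span (range delta)) (laplacian c)"
proof -
  from assms(2) obtain C where
    C: "\<And>u. u \<in> vectors ell2 \<Longrightarrow> hnorm (energy_space c) (mod_const u) \<le> C * hnorm ell2 u"
    by (auto simp: boundedly_contained_def bounded_op_def)
  have deg: "(\<Sum>y | c x y > 0. c x y) \<le> 2 * C\<^sup>2" for x
    using assms(1) C[OF finite_support_in_ell2]
    by (rule degree_le_if_energy_bound) (simp add: delta_def indicator_def)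
  have "hnorm ell2 (laplacian c u) \<le> 2 * C\<^sup>2 * hnorm ell2 u" if u: "u \<in> span (range delta)" for u
  proof (rule power2_le_imp_le)
    have fin: "finite {x. u x \<noteq> 0}" using u by (simp add: span_delta)
    have ell2: "u \<in> vectors ell2" using fin by (rule finite_support_in_ell2)
    have dom: "u \<in> dom_energy c" using assms(1) fin by (rule finite_support_in_dom_energy)
    let ?E = "(hnorm (energy_space c) (mod_const u))\<^sup>2"
    have "?E \<le> (C * hnorm ell2 u)\<^sup>2"
      using C[OF ell2] hnorm_energy_nonneg[OF assms(1)] by (rule power_mono)
    have "(\<Sum>\<^sub>\<infinity>x. (laplacian c u x)\<^sup>2) \<le> 2 * C\<^sup>2 * (2 * ?E)"
    proof (rule infsum_le_finite_sums)
      show "(\<lambda>x. (laplacian c u x)\<^sup>2) summable_on UNIV"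
        using laplacian_span_delta_ell2[OF assms(1) u] by (simp add: vectors_ell2_iff)
      fix F :: "'a set" assume "finite F"
      have "(\<Sum>x\<in>F. (laplacian c u x)\<^sup>2) \<le>
          (\<Sum>x\<in>F. 2 * C\<^sup>2 * (\<Sum>y | c x y > 0. pair_energy c u (x, y)))"
        using assms(1) deg
        by (intro sum_mono order_trans[OF laplacian_square_le] mult_right_mono)
          (auto intro!: sum_nonneg pair_energy_nonneg)
      also have "\<dots> = 2 * C\<^sup>2 * (\<Sum>x\<in>F. \<Sum>y | c x y > 0. pair_energy c u (x, y))"
        by (simp add: sum_distrib_left)
      also have "(\<Sum>x\<in>F. \<Sum>y | c x y > 0. pair_energy c u (x, y)) =
          sum (pair_energy c u) (SIGMA x:F. {y. c x y > 0})"
        using \<open>finite F\<close> assms(1) by (subst sum.Sigma) (auto simp: network_def case_prod_beta)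
      also have "2 * C\<^sup>2 * \<dots> \<le> 2 * C\<^sup>2 * (2 * ?E)"
        using \<open>finite F\<close> assms(1)
        by (intro mult_left_mono sum_pair_energy_le dom) (auto simp: network_def)
      finally show "(\<Sum>x\<in>F. (laplacian c u x)\<^sup>2) \<le> 2 * C\<^sup>2 * (2 * ?E)" .
    qed
    also have "\<dots> \<le> 2 * C\<^sup>2 * (2 * (C * hnorm ell2 u)\<^sup>2)"
      using \<open>?E \<le> _\<close> by (intro mult_left_mono) auto
    also have "\<dots> = (2 * C\<^sup>2 * hnorm ell2 u)\<^sup>2"
      by (simp add: power_mult_distrib power2_eq_square)
    finally show "(hnorm ell2 (laplacian c u))\<^sup>2 \<le> (2 * C\<^sup>2 * hnorm ell2 u)\<^sup>2"
      by (simp only: hnorm_ell2_square)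
  qed (simp add: hnorm_ell2_nonneg)
  then show ?thesis
    using laplacian_span_delta_ell2[OF assms(1)] by (auto simp: bounded_op_def)
qed


section \<open>Unbounded containment\<close>

theorem theorem3p23:
  fixes c :: "'a \<Rightarrow> 'a \<Rightarrow> real"
  assumes "network c"
    and "\<not> bounded_op ell2 ell2 (span (range delta)) (laplacian c)"
  shows "unboundedly_contained ell2 (energy_space c) mod_const"
  unfolding unboundedly_contained_def
proof (intro conjI exI)
  show "\<not> boundedly_contained ell2 (energy_space c) mod_const"
    using laplacian_bounded_if_boundedly_contained assms by blast
  show "subspace (span (range delta))" by (rule subspace_span)
  show ell2: "span (range delta) \<subseteq> vectors ell2"
    by (auto simp: span_delta intro: finite_support_in_ell2)
  show "dense_in ell2 (span (range delta))" by (rule dense_in_ell2_span_delta)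
  have dom: "span (range delta) \<subseteq> dom_energy c"
    using assms(1) by (auto simp: span_delta intro: finite_support_in_dom_energy)
  then show "mod_const ` span (range delta) \<subseteq> vectors (energy_space c)"
    by (auto simp: energy_space_def)
  show "closable_op ell2 (energy_space c) (span (range delta)) mod_const"
    unfolding closable_op_def single_valued_def
    using graph_closure_mod_const[OF assms(1) ell2 dom] by blast
qed

end
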